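(* Let $a<b$ be real numbers and let $\mathfrak{L}_n:\mathfrak{C}([a,b])\to\mathfrak{B}([a,b])$, $n\in\mathbb{N}$, be a sequence of positive linear operators. Let $p(u)=\sum_{n=1}^\infty p_nu^{n-1}$ be a power series with non-negative coefficients (not all zero) and radius of convergence $R\in(0,\infty]$. Then $$\lim_{u\to R^-}\frac1{p(u)}\sum_{n=1}^\infty\|\mathfrak{L}_n(g)-g\|\,p_nu^{n-1}=0\quad\text{for all } g\in\mathfrak{C}([a,b])$$ if and only if $$\lim_{u\to R^-}\frac1{p(u)}\sum_{n=1}^\infty\|\mathfrak{L}_n(g_i)-g_i\|\,p_nu^{n-1}=0\quad\text{for } i=0,1,2,$$ where $g_i(s)=s^i$.
   Context: $\mathfrak{B}([a,b])$ is the normed space of all bounded real functions on $[a,b]$ with the sup-norm $\|\cdot\|$, and $\mathfrak{C}([a,b])$ is its subspace of continuous functions. A linear operator is positive if it maps non-negative functions to non-negative functions. A limit statement $\lim_{u\to R^-}\frac1{p(u)}\sum_n x_np_nu^{n-1}=0$ (P-summability of $\langle x_n\rangle$ to $0$) includes the convergence of the series for $u<R$ sufficiently close to $R$. *)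

theory Defs
  imports "HOL-Analysis.Analysis"
begin

(* A function on [a,b] is represented by a total function real => real of which only
   the values on {a..b} matter. *)

definition continuous_functions :: "real \<Rightarrow> real \<Rightarrow> (real \<Rightarrow> real) set" where
  "continuous_functions a b = {f. continuous_on {a..b} f}"

definition bounded_functions :: "real \<Rightarrow> real \<Rightarrow> (real \<Rightarrow> real) set" where
  "bounded_functions a b = {f. bounded (f ` {a..b})}"

definition sup_norm :: "real \<Rightarrow> real \<Rightarrow> (real \<Rightarrow> real) \<Rightarrow> real" where
  "sup_norm a b f = (SUP x\<in>{a..b}. \<bar>f x\<bar>)"

definition linear_operator :: "real \<Rightarrow> real \<Rightarrow> ((real \<Rightarrow> real) \<Rightarrow> real \<Rightarrow> real) \<Rightarrow> bool" where
  "linear_operator a b T \<longleftrightarrow>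
     T \<in> continuous_functions a b \<rightarrow> bounded_functions a b \<and>
     (\<forall>f\<in>continuous_functions a b. \<forall>g\<in>continuous_functions a b. \<forall>x\<in>{a..b}.
        T (\<lambda>s. f s + g s) x = T f x + T g x) \<and>
     (\<forall>c. \<forall>f\<in>continuous_functions a b. \<forall>x\<in>{a..b}.
        T (\<lambda>s. c * f s) x = c * T f x)"

definition positive_operator :: "real \<Rightarrow> real \<Rightarrow> ((real \<Rightarrow> real) \<Rightarrow> real \<Rightarrow> real) \<Rightarrow> bool" where
  "positive_operator a b T \<longleftrightarrow>
     (\<forall>f\<in>continuous_functions a b. (\<forall>x\<in>{a..b}. 0 \<le> f x) \<longrightarrow> (\<forall>x\<in>{a..b}. 0 \<le> T f x))"

(* Independence of the representative need not be assumed: it follows from linearity and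
   positivity, so such a T is an operator on functions on [a,b]. *)
lemma positive_linear_operator_cong:
  assumes lin: "linear_operator a b T" and pos: "positive_operator a b T"
    and f: "f \<in> continuous_functions a b" and g: "g \<in> continuous_functions a b"
    and eq: "\<And>x. x \<in> {a..b} \<Longrightarrow> f x = g x" and x: "x \<in> {a..b}"
  shows "T f x = T g x"
proof -
  have le: "T f x \<le> T g x"
    if f: "f \<in> continuous_functions a b" and g: "g \<in> continuous_functions a b"
      and eq: "\<And>x. x \<in> {a..b} \<Longrightarrow> f x = g x" for f g
  proof -
    have mf: "(\<lambda>s. -1 * f s) \<in> continuous_functions a b"
      using f by (auto simp: continuous_functions_def intro!: continuous_intros)
    have d: "(\<lambda>s. g s + -1 * f s) \<in> continuous_functions a b"
      using f g by (auto simp: continuous_functions_def intro!: continuous_intros)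
    have "0 \<le> T (\<lambda>s. g s + -1 * f s) x"
      using pos d eq x unfolding positive_operator_def by force
    also have "\<dots> = T g x + T (\<lambda>s. -1 * f s) x"
      using lin g mf x unfolding linear_operator_def
      by (elim conjE) (drule bspec, assumption, drule bspec, assumption, drule bspec, assumption, assumption)
    also have "T (\<lambda>s. -1 * f s) x = -1 * T f x"
      using lin f x unfolding linear_operator_def by (elim conjE allE[of _ "-1"]) auto
    finally show ?thesis by simp
  qed
  show ?thesis
    using le[OF f g] le[OF g f] eq by (simp add: order_antisym)
qed

(* Sequences are indexed from 1 (the value at 0 is ignored): the sum over n >= 1 of
   p_n u^(n-1) is written with n replaced by Suc n. *)
definition power_series :: "(nat \<Rightarrow> real) \<Rightarrow> real \<Rightarrow> real" where
  "power_series p u = (\<Sum>n. p (Suc n) * u ^ n)"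

(* The limit u -> R- over real u, for R possibly infinite, is taken along the left
   neighbourhoods of R in ereal, where u is eventually finite.
   Since suminf is a total function, convergence is required explicitly. *)
definition P_summable_to :: "(nat \<Rightarrow> real) \<Rightarrow> ereal \<Rightarrow> (nat \<Rightarrow> real) \<Rightarrow> real \<Rightarrow> bool" where
  "P_summable_to p R x l \<longleftrightarrow>
     (\<forall>\<^sub>F u in at_left R. summable (\<lambda>n. x (Suc n) * p (Suc n) * real_of_ereal u ^ n)) \<and>
     (((\<lambda>u. 1 / power_series p u * (\<Sum>n. x (Suc n) * p (Suc n) * u ^ n)) \<circ> real_of_ereal)
        \<longlongrightarrow> l) (at_left R)"

end

(* As in Korovkin's theorem, uniform continuity gives |g t - g x| <= e + K (t - x)^2 on [a,b].
   Applying the positive operator L n in the variable t and expanding the square bounds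
   ||L n g - g|| by e plus a fixed multiple of the sum of the three test errors. Averaging
   with the weights p n u^(n-1) / p(u), whose sum is 1, preserves this bound, so the upper
   limit of the averages is at most e. *)
theory Submission
  imports Defs
begin

section \<open>Calculus of P-summability\<close>

text \<open>\<open>real_of_ereal\<close> sends both infinities to 0. On the interval from 0 to
  \<open>R\<close> neither occurs, since \<open>0 < u\<close> excludes one and \<open>u < R\<close>
  the other, so there it returns the genuine real value of \<open>u\<close>, also when
  \<open>R\<close> is infinite.\<close>

lemma eventually_at_left_ereal_real:
  fixes R :: ereal
  assumes "0 < R"
  shows "\<forall>\<^sub>F u in at_left R. 0 < real_of_ereal u \<and> ereal (real_of_ereal u) < R"
proof -
  have "\<forall>\<^sub>F u in at_left R. 0 < u \<and> u < R"
    using assms eventually_at_left[of 0 R] by auto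
  then show ?thesis
  proof eventually_elim
    case (elim u)
    then show ?case by (cases u) auto
  qed
qed

text \<open>Each series converges only for \<open>u\<close> close to \<open>R\<close>, so the
  averages add up only eventually; that is enough to carry the limit over.\<close>

lemma P_summable_to_add:
  assumes "P_summable_to p R x l" "P_summable_to p R y m"
  shows "P_summable_to p R (\<lambda>n. x n + y n) (l + m)"
proof -
  let ?f = "\<lambda>x u n. x (Suc n) * p (Suc n) * real_of_ereal u ^ n"
  let ?F = "\<lambda>x u. 1 / power_series p (real_of_ereal u) * (\<Sum>n. ?f x u n)"
  have sx: "\<forall>\<^sub>F u in at_left R. summable (?f x u)" and sy: "\<forall>\<^sub>F u in at_left R. summable (?f y u)"
    and lim: "(?F x \<longlongrightarrow> l) (at_left R)" "(?F y \<longlongrightarrow> m) (at_left R)"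
    using assms by (simp_all add: P_summable_to_def o_def)
  have *: "\<forall>\<^sub>F u in at_left R. summable (?f (\<lambda>n. x n + y n) u) \<and>
      ?F x u + ?F y u = ?F (\<lambda>n. x n + y n) u"
    using sx sy
  proof eventually_elim
    case (elim u)
    then show ?case
      using summable_add[OF elim] suminf_add[OF elim]
      by (simp add: distrib_right flip: add_divide_distrib)
  qed
  have "(?F (\<lambda>n. x n + y n) \<longlongrightarrow> l + m) (at_left R)"
    by (rule Lim_transform_eventually[OF tendsto_add[OF lim] eventually_mono[OF *]]) simp
  with * show ?thesis
    by (simp add: P_summable_to_def o_def eventually_conj_iff)
qed

lemma P_summable_to_cmult:
  assumes "P_summable_to p R x l"
  shows "P_summable_to p R (\<lambda>n. c * x n) (c * l)"
proof -
  let ?f = "\<lambda>x u n. x (Suc n) * p (Suc n) * real_of_ereal u ^ n"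
  let ?F = "\<lambda>x u. 1 / power_series p (real_of_ereal u) * (\<Sum>n. ?f x u n)"
  have sx: "\<forall>\<^sub>F u in at_left R. summable (?f x u)" and lim: "(?F x \<longlongrightarrow> l) (at_left R)"
    using assms by (simp_all add: P_summable_to_def o_def)
  have *: "\<forall>\<^sub>F u in at_left R. summable (?f (\<lambda>n. c * x n) u) \<and>
      c * ?F x u = ?F (\<lambda>n. c * x n) u"
    using sx
  proof eventually_elim
    case (elim u)
    then show ?case
      using summable_mult[OF elim, of c] suminf_mult[OF elim, of c] by (simp add: mult.assoc)
  qed
  have "(?F (\<lambda>n. c * x n) \<longlongrightarrow> c * l) (at_left R)"
    by (rule Lim_transform_eventually[OF tendsto_mult_left[OF lim] eventually_mono[OF *]]) simp
  with * show ?thesis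
    by (simp add: P_summable_to_def o_def eventually_conj_iff)
qed

text \<open>A constant \<open>e\<close> averages to \<open>e\<close>, so the upper limit of the
  averages of \<open>x\<close> is at most \<open>e\<close> for every \<open>e > 0\<close>. The bound
  \<open>y\<close> is chosen after \<open>e\<close>, which leaves room for constants that blow up as
  \<open>e\<close> shrinks.\<close>

lemma P_summable_to_0_dominated:
  assumes p_nonneg: "\<And>n. n \<ge> 1 \<Longrightarrow> 0 \<le> p n"
    and p_nonzero: "\<exists>n\<ge>1. p n \<noteq> 0"
    and R: "conv_radius (\<lambda>n. p (Suc n)) = R" "0 < R"
    and x_nonneg: "\<And>n. n \<ge> 1 \<Longrightarrow> 0 \<le> x n"
    and dom: "\<And>e. 0 < e \<Longrightarrow> \<exists>y. P_summable_to p R y 0 \<and> (\<forall>n\<ge>1. x n \<le> e + y n)"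
  shows "P_summable_to p R x 0"
proof -
  let ?f = "\<lambda>x u n. x (Suc n) * p (Suc n) * real_of_ereal u ^ n"
  let ?F = "\<lambda>x u. 1 / power_series p (real_of_ereal u) * (\<Sum>n. ?f x u n)"
  \<comment> \<open>Division by \<open>power_series p\<close> is meaningful near \<open>R\<close>:
    the series converges inside its radius of convergence, and since \<open>u > 0\<close> a single
    nonzero coefficient makes its sum strictly positive.\<close>
  have pu: "\<forall>\<^sub>F u in at_left R. 0 < real_of_ereal u
      \<and> summable (\<lambda>n. p (Suc n) * real_of_ereal u ^ n) \<and> 0 < power_series p (real_of_ereal u)"
    using eventually_at_left_ereal_real[OF R(2)]
  proof eventually_elim
    case (elim u)
    let ?u = "real_of_ereal u"
    have s: "summable (\<lambda>n. p (Suc n) * ?u ^ n)"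
      using elim R(1) by (intro summable_in_conv_radius) (simp del: abs_real_of_ereal)
    obtain k where k: "p (Suc k) \<noteq> 0"
      using p_nonzero by (metis Suc_le_D One_nat_def)
    have "0 < (\<Sum>n. p (Suc n) * ?u ^ n)"
    proof (rule suminf_pos2[OF s, of k])
      show "0 \<le> p (Suc n) * ?u ^ n" for n
        using p_nonneg[of "Suc n"] elim by simp
      show "0 < p (Suc k) * ?u ^ k"
        using p_nonneg[of "Suc k"] k elim by simp
    qed
    with s elim show ?case by (simp add: power_series_def)
  qed
  \<comment> \<open>The comparison for fixed \<open>e\<close> and \<open>y\<close> serves twice:
    with \<open>e = 1\<close> for the convergence of the series of \<open>x\<close>, and with half
    the target accuracy for its limit.\<close>
  have main: "\<forall>\<^sub>F u in at_left R. summable (?f x u) \<and> 0 \<le> ?F x u \<and> ?F x u \<le> e + ?F y u"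
    if y: "P_summable_to p R y 0" and le: "\<forall>n\<ge>1. x n \<le> e + y n" for e y
  proof -
    have "\<forall>\<^sub>F u in at_left R. summable (?f y u)"
      using y by (simp add: P_summable_to_def)
    with pu show ?thesis
    proof eventually_elim
      case (elim u)
      let ?u = "real_of_ereal u" and ?P = "power_series p (real_of_ereal u)"
      from elim have P: "0 < ?P" by blast
      have s: "summable (\<lambda>n. e * (p (Suc n) * ?u ^ n) + ?f y u n)"
        using elim by (intro summable_add summable_mult) auto
      have nn: "0 \<le> ?f x u n" for n
        using p_nonneg[of "Suc n"] x_nonneg[of "Suc n"] elim by simp
      have ub: "?f x u n \<le> e * (p (Suc n) * ?u ^ n) + ?f y u n" for n
      proof -
        have "x (Suc n) * (p (Suc n) * ?u ^ n) \<le> (e + y (Suc n)) * (p (Suc n) * ?u ^ n)"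
          using le p_nonneg[of "Suc n"] elim by (intro mult_right_mono) auto
        then show ?thesis by (simp add: algebra_simps)
      qed
      have sx: "summable (?f x u)"
        using nn ub by (intro summable_comparison_test'[OF s, of 0]) auto
      have "(\<Sum>n. ?f x u n) \<le> (\<Sum>n. e * (p (Suc n) * ?u ^ n) + ?f y u n)"
        by (rule suminf_le[OF ub sx s])
      also have "\<dots> = e * ?P + (\<Sum>n. ?f y u n)"
        using elim by (simp add: suminf_add[symmetric] suminf_mult summable_mult power_series_def)
      finally have "?F x u \<le> 1 / ?P * (e * ?P + (\<Sum>n. ?f y u n))"
        using P by (intro mult_left_mono) auto
      also have "\<dots> = e + ?F y u"
        using P by (simp add: field_simps)
      finally show ?case
        using sx suminf_nonneg[OF sx nn] P by simp
    qed
  qed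
  obtain y where "P_summable_to p R y 0" "\<forall>n\<ge>1. x n \<le> 1 + y n"
    using dom[of 1] by auto
  then have summ: "\<forall>\<^sub>F u in at_left R. summable (?f x u)"
    by (rule eventually_mono[OF main]) simp
  have lim: "(?F x \<longlongrightarrow> 0) (at_left R)"
  proof (rule tendstoI)
    fix e :: real
    assume e: "0 < e"
    obtain y where y: "P_summable_to p R y 0" "\<forall>n\<ge>1. x n \<le> e / 2 + y n"
      using dom[of "e / 2"] e by auto
    have "(?F y \<longlongrightarrow> 0) (at_left R)"
      using y(1) by (simp add: P_summable_to_def o_def)
    then have "\<forall>\<^sub>F u in at_left R. ?F y u < e / 2"
      using e by (intro order_tendstoD(2)) auto
    with main[OF y] show "\<forall>\<^sub>F u in at_left R. dist (?F x u) 0 < e"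
    proof eventually_elim
      case (elim u)
      then have "0 \<le> ?F x u" "?F x u < e" by linarith+
      then show ?case by simp
    qed
  qed
  show ?thesis
    using summ lim by (simp add: P_summable_to_def o_def)
qed

section \<open>Sup-norm, continuous functions and positive linear operators\<close>

text \<open>The real supremum is an upper bound only for sets bounded above, which membership in
  \<open>bounded_functions\<close> provides.\<close>

lemma sup_norm_upper:
  assumes "f \<in> bounded_functions a b" "x \<in> {a..b}"
  shows "\<bar>f x\<bar> \<le> sup_norm a b f"
proof -
  have "bdd_above ((\<lambda>x. \<bar>f x\<bar>) ` {a..b})"
    using assms(1) by (auto simp: bounded_functions_def bounded_iff intro: bdd_aboveI)
  then show ?thesis
    unfolding sup_norm_def by (rule cSUP_upper[OF assms(2)])
qed

lemma sup_norm_least: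
  assumes "a \<le> b" "\<And>x. x \<in> {a..b} \<Longrightarrow> \<bar>f x\<bar> \<le> C"
  shows "sup_norm a b f \<le> C"
  unfolding sup_norm_def using assms by (intro cSUP_least) auto

lemma continuous_functions_bounded:
  "f \<in> continuous_functions a b \<Longrightarrow> f \<in> bounded_functions a b"
  unfolding continuous_functions_def bounded_functions_def
  by (auto intro: compact_imp_bounded compact_continuous_image)

lemma bounded_functions_diff:
  assumes "f \<in> bounded_functions a b" "g \<in> bounded_functions a b"
  shows "(\<lambda>x. f x - g x) \<in> bounded_functions a b"
  using assms bounded_minus_comp[of f "{a..b}" g] by (simp add: bounded_functions_def)

lemma continuous_functions_add:
  "f \<in> continuous_functions a b \<Longrightarrow> g \<in> continuous_functions a b \<Longrightarrow>
    (\<lambda>s. f s + g s) \<in> continuous_functions a b"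
  by (auto simp: continuous_functions_def intro: continuous_on_add)

lemma continuous_functions_cmult:
  "f \<in> continuous_functions a b \<Longrightarrow> (\<lambda>s. c * f s) \<in> continuous_functions a b"
  by (auto simp: continuous_functions_def intro: continuous_on_mult_left)

lemma continuous_functions_power:
  "(\<lambda>s. s ^ i) \<in> continuous_functions a b"
  by (auto simp: continuous_functions_def intro!: continuous_intros)

lemma linear_operator_add:
  "\<lbrakk>linear_operator a b T; f \<in> continuous_functions a b; g \<in> continuous_functions a b; x \<in> {a..b}\<rbrakk>
    \<Longrightarrow> T (\<lambda>s. f s + g s) x = T f x + T g x"
  unfolding linear_operator_def by blast

lemma linear_operator_cmult:
  "\<lbrakk>linear_operator a b T; f \<in> continuous_functions a b; x \<in> {a..b}\<rbrakk>
    \<Longrightarrow> T (\<lambda>s. c * f s) x = c * T f x"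
  unfolding linear_operator_def by blast

lemma linear_operator_bounded:
  "linear_operator a b T \<Longrightarrow> f \<in> continuous_functions a b \<Longrightarrow> T f \<in> bounded_functions a b"
  unfolding linear_operator_def by blast

text \<open>Positivity is applied to the difference, written as \<open>g s + -1 * f s\<close>
  because linearity is stated for sums and scalar multiples.\<close>

lemma positive_linear_operator_mono:
  assumes lin: "linear_operator a b T" and pos: "positive_operator a b T"
    and f: "f \<in> continuous_functions a b" and g: "g \<in> continuous_functions a b"
    and le: "\<And>x. x \<in> {a..b} \<Longrightarrow> f x \<le> g x" and x: "x \<in> {a..b}"
  shows "T f x \<le> T g x"
proof -
  have mf: "(\<lambda>s. -1 * f s) \<in> continuous_functions a b"
    by (rule continuous_functions_cmult[OF f])
  have "0 \<le> T (\<lambda>s. g s + -1 * f s) x"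
    using pos continuous_functions_add[OF g mf] le x unfolding positive_operator_def by force
  also have "\<dots> = T g x - T f x"
    using linear_operator_add[OF lin g mf x] linear_operator_cmult[OF lin f x, of "-1"] by simp
  finally show ?thesis by simp
qed

text \<open>Both sides of the Korovkin inequality are instances of this one shape. The powers stay
  in the form \<open>s ^ 0\<close>, \<open>s ^ 1\<close>, \<open>s ^ 2\<close> so that they match
  the test functions literally.\<close>

lemma linear_operator_quadratic:
  assumes lin: "linear_operator a b T" and f: "f \<in> continuous_functions a b" and x: "x \<in> {a..b}"
  shows "(\<lambda>s. c * f s + (c0 * s ^ 0 + (c1 * s ^ 1 + c2 * s ^ 2))) \<in> continuous_functions a b"
    and "T (\<lambda>s. c * f s + (c0 * s ^ 0 + (c1 * s ^ 1 + c2 * s ^ 2))) x =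
      c * T f x + (c0 * T (\<lambda>s. s ^ 0) x + (c1 * T (\<lambda>s. s ^ 1) x + c2 * T (\<lambda>s. s ^ 2) x))"
proof -
  note cont = continuous_functions_add continuous_functions_cmult continuous_functions_power f
  show "(\<lambda>s. c * f s + (c0 * s ^ 0 + (c1 * s ^ 1 + c2 * s ^ 2))) \<in> continuous_functions a b"
    by (intro cont)
  show "T (\<lambda>s. c * f s + (c0 * s ^ 0 + (c1 * s ^ 1 + c2 * s ^ 2))) x =
      c * T f x + (c0 * T (\<lambda>s. s ^ 0) x + (c1 * T (\<lambda>s. s ^ 1) x + c2 * T (\<lambda>s. s ^ 2) x))"
    by (subst linear_operator_add[OF lin _ _ x] linear_operator_cmult[OF lin _ x], (intro cont)+)+ simp
qed

section \<open>Korovkin's estimate\<close>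

text \<open>For \<open>t\<close> within \<open>d\<close> of \<open>x\<close>, uniform continuity
  gives the bound \<open>e\<close>. Farther away \<open>(t - x)\<^sup>2 / d\<^sup>2\<close> is at
  least 1, so \<open>2 * M\<close> times it dominates the trivial bound \<open>2 * M\<close>; hence
  \<open>K\<close> is \<open>2 * M / d\<^sup>2\<close>.\<close>

lemma continuous_quadratic_modulus:
  assumes g: "g \<in> continuous_functions a b" and e: "0 < e"
  obtains K where "0 \<le> K" "\<And>x t. x \<in> {a..b} \<Longrightarrow> t \<in> {a..b} \<Longrightarrow> \<bar>g t - g x\<bar> \<le> e + K * (t - x)\<^sup>2"
proof -
  have "uniformly_continuous_on {a..b} g"
    using g by (auto simp: continuous_functions_def intro: compact_uniformly_continuous)
  then obtain d where d: "0 < d"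
    "\<And>x t. x \<in> {a..b} \<Longrightarrow> t \<in> {a..b} \<Longrightarrow> dist t x < d \<Longrightarrow> dist (g t) (g x) < e"
    using e unfolding uniformly_continuous_on_def by metis
  \<comment> \<open>The interval may be empty here, where the supremum has no known sign; the
    absolute value secures \<open>0 \<le> M\<close>.\<close>
  define M where "M = \<bar>sup_norm a b g\<bar>"
  have M: "\<bar>g x\<bar> \<le> M" if "x \<in> {a..b}" for x
    using sup_norm_upper[OF continuous_functions_bounded[OF g] that] by (simp add: M_def)
  have M0: "0 \<le> M" by (simp add: M_def)
  show ?thesis
  proof
    show "0 \<le> 2 * M / d\<^sup>2" using M0 by simp
    fix x t
    assume xt: "x \<in> {a..b}" "t \<in> {a..b}"
    show "\<bar>g t - g x\<bar> \<le> e + 2 * M / d\<^sup>2 * (t - x)\<^sup>2"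
    proof (cases "\<bar>t - x\<bar> < d")
      case True
      then have "\<bar>g t - g x\<bar> < e" using d(2)[OF xt] by (simp add: dist_real_def)
      moreover have "0 \<le> 2 * M / d\<^sup>2 * (t - x)\<^sup>2" using M0 by simp
      ultimately show ?thesis by linarith
    next
      case False
      then have "d\<^sup>2 \<le> (t - x)\<^sup>2"
        using d(1) by (simp add: abs_le_square_iff[symmetric])
      then have "2 * M * 1 \<le> 2 * M * ((t - x)\<^sup>2 / d\<^sup>2)"
        using d(1) M0 by (intro mult_left_mono) auto
      then show ?thesis
        using M[OF xt(1)] M[OF xt(2)] e by simp
    qed
  qed
qed

text \<open>\<open>C\<close> is fixed before \<open>T\<close>: it depends on \<open>g\<close>,
  \<open>e\<close> and the interval alone, so one constant serves all operators of a
  sequence.\<close>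

lemma korovkin_estimate:
  assumes ab: "a \<le> b" and g: "g \<in> continuous_functions a b" and e: "0 < e"
  obtains C where "\<And>T. linear_operator a b T \<Longrightarrow> positive_operator a b T \<Longrightarrow>
    sup_norm a b (\<lambda>s. T g s - g s) \<le> e + C * (sup_norm a b (\<lambda>s. T (\<lambda>t. t ^ 0) s - s ^ 0)
      + (sup_norm a b (\<lambda>s. T (\<lambda>t. t ^ 1) s - s ^ 1) + sup_norm a b (\<lambda>s. T (\<lambda>t. t ^ 2) s - s ^ 2)))"
proof -
  obtain K where K: "0 \<le> K"
    "\<And>x t. x \<in> {a..b} \<Longrightarrow> t \<in> {a..b} \<Longrightarrow> \<bar>g t - g x\<bar> \<le> e + K * (t - x)\<^sup>2"
    using continuous_quadratic_modulus[OF g e] by blast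
  define M where "M = sup_norm a b g"
  define c where "c = max \<bar>a\<bar> \<bar>b\<bar>"
  \<comment> \<open>\<open>e + M\<close> pays for the error of \<open>T\<close> on constants;
    \<open>c\<^sup>2\<close>, \<open>2 * c\<close> and \<open>1\<close> bound the coefficients of
    \<open>(t - x)\<^sup>2\<close>, expanded in powers of \<open>t\<close>.\<close>
  define C where "C = e + M + K * (c\<^sup>2 + 2 * c + 1)"
  have c0: "0 \<le> c" by (simp add: c_def)
  have M: "\<bar>g x\<bar> \<le> M" if "x \<in> {a..b}" for x
    using sup_norm_upper[OF continuous_functions_bounded[OF g] that] by (simp add: M_def)
  have M0: "0 \<le> M" using M[of a] ab by simp
  show ?thesis
  proof
    fix T
    assume lin: "linear_operator a b T" and pos: "positive_operator a b T"
    define N where "N i = sup_norm a b (\<lambda>s. T (\<lambda>t. t ^ i) s - s ^ i)" for i :: nat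
    have N: "\<bar>T (\<lambda>t. t ^ i) x - x ^ i\<bar> \<le> N i" if "x \<in> {a..b}" for i x
      unfolding N_def
      by (rule sup_norm_upper[OF bounded_functions_diff that])
        (intro linear_operator_bounded[OF lin] continuous_functions_bounded
          continuous_functions_power)+
    have "\<bar>T g x - g x\<bar> \<le> e + C * (N 0 + (N 1 + N 2))" if x: "x \<in> {a..b}" for x
    proof -
      define D where "D i = T (\<lambda>t. t ^ i) x - x ^ i" for i :: nat
      \<comment> \<open>This is the value at \<open>x\<close> of \<open>T\<close> applied to
        \<open>(t - x)\<^sup>2\<close>: in the expansion the exact powers of \<open>x\<close> cancel
        and only the errors \<open>D i\<close> remain.\<close>
      define Q where "Q = x\<^sup>2 * D 0 - 2 * x * D 1 + D 2"
      have D: "\<bar>D i\<bar> \<le> N i" for i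
        using N[OF x] by (simp add: D_def)
      then have N0: "0 \<le> N i" for i
        by (meson abs_ge_zero order_trans)
      have xc: "\<bar>x\<bar> \<le> c" using x by (auto simp: c_def)
      \<comment> \<open>The signs \<open>s = 1\<close> and \<open>s = -1\<close> together bound the
        absolute value, so one computation covers both sides.\<close>
      have key: "s * (T g x - g x) \<le> e + (e + M) * \<bar>D 0\<bar> + K * Q" if s: "\<bar>s\<bar> = 1" for s
      proof -
        \<comment> \<open>The inequality
          \<open>s * (g t - g x) \<le> e + K * (t - x)\<^sup>2\<close>, with \<open>x\<close> fixed
          and \<open>t\<close> variable, is padded with zero coefficients to fit the shape of
          \<open>linear_operator_quadratic\<close>.\<close>
        have "s * g t + (- (s * g x) * t ^ 0 + (0 * t ^ 1 + 0 * t ^ 2))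
            \<le> 0 * g t + ((e + K * x\<^sup>2) * t ^ 0 + (- 2 * K * x * t ^ 1 + K * t ^ 2))"
          if t: "t \<in> {a..b}" for t
        proof -
          have "s * (g t - g x) \<le> \<bar>g t - g x\<bar>"
            using s by (metis abs_ge_self abs_mult mult_1)
          also have "\<dots> \<le> e + K * (t - x)\<^sup>2" by (rule K(2)[OF x t])
          finally show ?thesis by (simp add: power2_eq_square algebra_simps)
        qed
        note positive_linear_operator_mono[OF lin pos linear_operator_quadratic(1)[OF lin g x]
            linear_operator_quadratic(1)[OF lin g x] this x]
        then have "s * T g x + - (s * g x) * T (\<lambda>t. t ^ 0) x \<le> (e + K * x\<^sup>2) * T (\<lambda>t. t ^ 0) x
            + (- 2 * K * x * T (\<lambda>t. t ^ 1) x + K * T (\<lambda>t. t ^ 2) x)"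
          unfolding linear_operator_quadratic(2)[OF lin g x] by simp
        \<comment> \<open>Each \<open>T (\<lambda>t. t ^ i) x\<close> is replaced by
          \<open>x ^ i + D i\<close>. The terms \<open>e * D 0\<close> and
          \<open>s * g x * D 0\<close> arise because \<open>T\<close> need not fix the constant
          1.\<close>
        then have "s * (T g x - g x) \<le> e + e * D 0 + s * g x * D 0 + K * Q"
          by (simp add: D_def Q_def power2_eq_square algebra_simps)
        moreover have "s * g x * D 0 \<le> M * \<bar>D 0\<bar>"
        proof -
          have "s * g x * D 0 \<le> \<bar>s\<bar> * \<bar>g x\<bar> * \<bar>D 0\<bar>"
            by (metis abs_ge_self abs_mult)
          also have "\<dots> \<le> M * \<bar>D 0\<bar>"
            using s M[OF x] by (simp add: mult_right_mono)
          finally show ?thesis .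
        qed
        moreover have "e * D 0 \<le> e * \<bar>D 0\<bar>"
          using e by simp
        ultimately show ?thesis by (simp add: distrib_right)
      qed
      have "\<bar>T g x - g x\<bar> \<le> e + (e + M) * \<bar>D 0\<bar> + K * Q"
        using key[of 1] key[of "-1"] by (simp add: abs_le_iff)
      also have "\<dots> \<le> e + (e + M) * (N 0 + (N 1 + N 2))
          + K * ((c\<^sup>2 + 2 * c + 1) * (N 0 + (N 1 + N 2)))"
      proof (intro add_mono mult_left_mono order_refl)
        show "\<bar>D 0\<bar> \<le> N 0 + (N 1 + N 2)"
          using D[of 0] N0[of 1] N0[of 2] by linarith
        have "x\<^sup>2 * D 0 \<le> c\<^sup>2 * N 0"
        proof -
          have "x\<^sup>2 * D 0 \<le> \<bar>x\<bar>\<^sup>2 * \<bar>D 0\<bar>" by (simp add: mult_left_mono)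
          also have "\<dots> \<le> c\<^sup>2 * N 0"
            using xc D[of 0] by (intro mult_mono power_mono) auto
          finally show ?thesis .
        qed
        moreover have "- 2 * x * D 1 \<le> 2 * c * N 1"
        proof -
          have "- (x * D 1) \<le> \<bar>x\<bar> * \<bar>D 1\<bar>" by (metis abs_ge_minus_self abs_mult)
          also have "\<dots> \<le> c * N 1"
            using xc c0 D[of 1] by (intro mult_mono) auto
          finally show ?thesis by simp
        qed
        moreover have "D 2 \<le> N 2" using D[of 2] by linarith
        ultimately have "Q \<le> c\<^sup>2 * N 0 + 2 * c * N 1 + 1 * N 2" by (simp add: Q_def)
        \<comment> \<open>Since \<open>c\<close> and all \<open>N i\<close> are nonnegative, each of
          the three coefficients may be raised to their sum, which leaves a single factor.\<close>
        also have "\<dots> \<le> (c\<^sup>2 + 2 * c + 1) * N 0 + (c\<^sup>2 + 2 * c + 1) * N 1 + (c\<^sup>2 + 2 * c + 1) * N 2"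
          using N0 c0 by (intro add_mono mult_right_mono) auto
        finally show "Q \<le> (c\<^sup>2 + 2 * c + 1) * (N 0 + (N 1 + N 2))"
          by (simp only: distrib_left add.assoc)
      qed (use e M0 K(1) in auto)
      also have "\<dots> = e + C * (N 0 + (N 1 + N 2))"
        by (simp add: C_def algebra_simps)
      finally show ?thesis .
    qed
    then show "sup_norm a b (\<lambda>s. T g s - g s) \<le> e + C * (sup_norm a b (\<lambda>s. T (\<lambda>t. t ^ 0) s - s ^ 0)
        + (sup_norm a b (\<lambda>s. T (\<lambda>t. t ^ 1) s - s ^ 1) + sup_norm a b (\<lambda>s. T (\<lambda>t. t ^ 2) s - s ^ 2)))"
      unfolding N_def by (rule sup_norm_least[OF ab])
  qed
qed

section \<open>From the three test functions to all continuous functions\<close>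

theorem theorem3:
  fixes a b :: real
    and L :: "nat \<Rightarrow> (real \<Rightarrow> real) \<Rightarrow> real \<Rightarrow> real"
    and p :: "nat \<Rightarrow> real" and R :: ereal
  assumes "a < b"
    and "\<And>n. n \<ge> 1 \<Longrightarrow> linear_operator a b (L n)"
    and "\<And>n. n \<ge> 1 \<Longrightarrow> positive_operator a b (L n)"
    and "\<And>n. n \<ge> 1 \<Longrightarrow> 0 \<le> p n"
    and "\<exists>n\<ge>1. p n \<noteq> 0"
    and "conv_radius (\<lambda>n. p (Suc n)) = R"
    and "0 < R"
  shows "(\<forall>g\<in>continuous_functions a b.
            P_summable_to p R (\<lambda>n. sup_norm a b (\<lambda>s. L n g s - g s)) 0) \<longleftrightarrow>
         (\<forall>i\<in>{0, 1, 2::nat}.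
            P_summable_to p R (\<lambda>n. sup_norm a b (\<lambda>s. L n (\<lambda>t. t ^ i) s - s ^ i)) 0)"
proof
  assume all: "\<forall>g\<in>continuous_functions a b.
    P_summable_to p R (\<lambda>n. sup_norm a b (\<lambda>s. L n g s - g s)) 0"
  show "\<forall>i\<in>{0, 1, 2::nat}.
      P_summable_to p R (\<lambda>n. sup_norm a b (\<lambda>s. L n (\<lambda>t. t ^ i) s - s ^ i)) 0"
    by (intro ballI bspec[OF all] continuous_functions_power)
next
  define N where "N i n = sup_norm a b (\<lambda>s. L n (\<lambda>t. t ^ i) s - s ^ i)" for i n :: nat
  assume "\<forall>i\<in>{0, 1, 2::nat}.
    P_summable_to p R (\<lambda>n. sup_norm a b (\<lambda>s. L n (\<lambda>t. t ^ i) s - s ^ i)) 0"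
  then have test: "P_summable_to p R (N i) 0" if "i \<in> {0, 1, 2}" for i
    using that unfolding N_def by blast
  \<comment> \<open>This is the dominating sequence; \<open>C\<close> stays arbitrary because its
    value depends on \<open>g\<close> and \<open>e\<close>.\<close>
  have sum: "P_summable_to p R (\<lambda>n. C * (N 0 n + (N 1 n + N 2 n))) 0" for C
    using P_summable_to_cmult[OF P_summable_to_add[OF test[of 0]
          P_summable_to_add[OF test[of 1] test[of 2]]], of C] by simp
  show "\<forall>g\<in>continuous_functions a b.
    P_summable_to p R (\<lambda>n. sup_norm a b (\<lambda>s. L n g s - g s)) 0"
  proof
    fix g
    assume g: "g \<in> continuous_functions a b"
    show "P_summable_to p R (\<lambda>n. sup_norm a b (\<lambda>s. L n g s - g s)) 0"
    proof (rule P_summable_to_0_dominated[OF assms(4-7)])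
      fix n :: nat
      assume n: "n \<ge> 1"
      \<comment> \<open>The norm is nonnegative because it bounds an absolute value at some point of
        the interval; the endpoint \<open>a\<close> serves.\<close>
      have "\<bar>L n g a - g a\<bar> \<le> sup_norm a b (\<lambda>s. L n g s - g s)"
        using assms(1) by (intro sup_norm_upper bounded_functions_diff
            linear_operator_bounded[OF assms(2)[OF n] g] continuous_functions_bounded[OF g]) simp
      then show "0 \<le> sup_norm a b (\<lambda>s. L n g s - g s)" by linarith
    next
      fix e :: real
      assume "0 < e"
      then obtain C where "\<And>T. linear_operator a b T \<Longrightarrow> positive_operator a b T \<Longrightarrow>
          sup_norm a b (\<lambda>s. T g s - g s) \<le> e + C * (sup_norm a b (\<lambda>s. T (\<lambda>t. t ^ 0) s - s ^ 0)
            + (sup_norm a b (\<lambda>s. T (\<lambda>t. t ^ 1) s - s ^ 1)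
              + sup_norm a b (\<lambda>s. T (\<lambda>t. t ^ 2) s - s ^ 2)))"
        using korovkin_estimate[OF less_imp_le[OF assms(1)] g] by blast
      then have "\<forall>n\<ge>1. sup_norm a b (\<lambda>s. L n g s - g s) \<le> e + C * (N 0 n + (N 1 n + N 2 n))"
        unfolding N_def using assms(2,3) by blast
      with sum[of C] show "\<exists>y. P_summable_to p R y 0 \<and>
          (\<forall>n\<ge>1. sup_norm a b (\<lambda>s. L n g s - g s) \<le> e + y n)"
        by blast
    qed
  qed
qed

end
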